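(* Let $E = \sum_{n=1}^{\infty} \frac{1}{2^n - 1} = \sum_{n=1}^{\infty} \frac{d(n)}{2^n}$ (the Erdős–Borwein constant). Then the block $11$ (two consecutive binary digits both equal to $1$) appears infinitely often in the base-$2$ expansion of $E$; that is, there are infinitely many positive integers $n$ such that the $n$-th and $(n+1)$-th binary digits of $E$ after the binary point are both equal to $1$.
   Context: For a positive integer $n$, $d(n)$ denotes the number of positive divisors of $n$. The constant $E$ is irrational, so its binary expansion is unique. *)

theory Defs
  imports "HOL-Analysis.Analysis"
begin

definition divisor_count :: "nat \<Rightarrow> nat" where
  "divisor_count n = card {k. k dvd n}"

definition erdos_borwein :: real where
  "erdos_borwein = (\<Sum>n. 1 / (2 ^ Suc n - 1))"

text \<open>
  The digit of weight \<open>2\<^sup>-\<^sup>n\<close>, so that \<open>n = 1\<close> is the first digit after the binary point.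
  For dyadic rationals this selects the terminating expansion.
\<close>

definition binary_digit :: "real \<Rightarrow> nat \<Rightarrow> int" where
  "binary_digit x n = \<lfloor>2 ^ n * x\<rfloor> mod 2"

lemma binary_digit_cases: "binary_digit x n = 0 \<or> binary_digit x n = 1"
  unfolding binary_digit_def by presburger

lemma binary_digit_Suc:
  "binary_digit x (Suc n) = \<lfloor>2 ^ Suc n * x\<rfloor> - 2 * \<lfloor>2 ^ n * x\<rfloor>"
proof -
  define y where "y = 2 ^ n * x"
  have "\<lfloor>2 * y\<rfloor> = 2 * \<lfloor>y\<rfloor> \<or> \<lfloor>2 * y\<rfloor> = 2 * \<lfloor>y\<rfloor> + 1"
    by linarith
  hence "\<lfloor>2 * y\<rfloor> mod 2 = \<lfloor>2 * y\<rfloor> - 2 * \<lfloor>y\<rfloor>"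
    by auto
  thus ?thesis
    by (simp add: binary_digit_def y_def mult.assoc)
qed

lemma binary_digit_sums:
  "(\<lambda>n. real_of_int (binary_digit x (Suc n)) / 2 ^ Suc n) sums frac x"
proof -
  have partial: "(\<Sum>n<N. real_of_int (binary_digit x (Suc n)) / 2 ^ Suc n)
      = \<lfloor>2 ^ N * x\<rfloor> / 2 ^ N - \<lfloor>x\<rfloor>" for N
    by (induction N) (simp_all add: binary_digit_Suc field_simps)
  have "(\<lambda>N. \<lfloor>2 ^ N * x\<rfloor> / 2 ^ N) \<longlonglongrightarrow> x"
  proof (rule tendsto_sandwich)
    show "\<forall>\<^sub>F N in sequentially. x - (1 / 2) ^ N \<le> \<lfloor>2 ^ N * x\<rfloor> / 2 ^ N"
    proof (rule always_eventually, rule allI)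
      fix N :: nat
      have "2 ^ N * x - 1 \<le> \<lfloor>2 ^ N * x\<rfloor>" by linarith
      hence "(2 ^ N * x - 1) / 2 ^ N \<le> \<lfloor>2 ^ N * x\<rfloor> / 2 ^ N"
        by (rule divide_right_mono) simp
      thus "x - (1 / 2) ^ N \<le> \<lfloor>2 ^ N * x\<rfloor> / 2 ^ N"
        by (simp add: diff_divide_distrib power_divide)
    qed
    show "\<forall>\<^sub>F N in sequentially. \<lfloor>2 ^ N * x\<rfloor> / 2 ^ N \<le> x"
    proof (rule always_eventually, rule allI)
      fix N :: nat
      have "\<lfloor>2 ^ N * x\<rfloor> \<le> 2 ^ N * x" by linarith
      thus "\<lfloor>2 ^ N * x\<rfloor> / 2 ^ N \<le> x"
        by (simp add: field_simps)
    qed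
    have "(\<lambda>N. x - (1 / 2) ^ N) \<longlonglongrightarrow> x - 0"
      by (intro tendsto_intros LIMSEQ_power_zero) simp
    thus "(\<lambda>N. x - (1 / 2) ^ N) \<longlonglongrightarrow> x" by simp
  qed simp
  hence "(\<lambda>N. \<lfloor>2 ^ N * x\<rfloor> / 2 ^ N - \<lfloor>x\<rfloor>) \<longlonglongrightarrow> x - \<lfloor>x\<rfloor>"
    by (intro tendsto_intros)
  thus ?thesis
    by (simp only: sums_def partial frac_def)
qed

lemma summable_erdos_borwein: "summable (\<lambda>n. 1 / (2 ^ Suc n - 1) :: real)"
proof (rule summable_comparison_test')
  show "summable (\<lambda>n. (1 / 2) ^ n :: real)"
    by (rule summable_geometric) simp
  fix n :: nat
  have "(1::real) \<le> 2 ^ n" by simp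
  hence "(2::real) ^ n \<le> 2 ^ Suc n - 1" unfolding power_Suc by linarith
  moreover from this have "(0::real) < 2 ^ Suc n - 1"
    using zero_less_power[of "2::real" n] by linarith
  ultimately show "norm (1 / (2 ^ Suc n - 1) :: real) \<le> (1 / 2) ^ n"
    by (simp add: power_divide frac_le)
qed

lemma erdos_borwein_sums: "(\<lambda>n. 1 / (2 ^ Suc n - 1)) sums erdos_borwein"
  unfolding erdos_borwein_def using summable_erdos_borwein by (rule summable_sums)

lemma erdos_borwein_sums_divisor_count:
  "(\<lambda>n. real (divisor_count (Suc n)) / 2 ^ Suc n) sums erdos_borwein"
proof -
  define f :: "nat \<times> nat \<Rightarrow> real" where "f = (\<lambda>(m, k). (1 / 2) ^ (Suc m * Suc k))"
  have row: "((\<lambda>k. f (m, k)) has_sum 1 / (2 ^ Suc m - 1)) UNIV" for m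
  proof (rule sums_nonneg_imp_has_sum)
    define q :: real where "q = (1 / 2) ^ Suc m"
    have q: "0 < q" "q < 1"
      unfolding q_def by (simp, rule power_Suc_less_one) simp_all
    have "(\<lambda>k. q * q ^ k) sums (q * (1 / (1 - q)))"
      using q by (intro sums_mult geometric_sums) simp
    moreover have "f (m, k) = q * q ^ k" for k
      unfolding f_def q_def prod.case power_mult by simp
    moreover have "2 ^ Suc m = 1 / q" unfolding q_def by (simp add: power_divide)
    hence "1 / (2 ^ Suc m - 1) = 1 / (1 / q - 1)" by (simp only:)
    hence "1 / (2 ^ Suc m - 1) = q * (1 / (1 - q))"
      using q by (simp add: field_simps del: power_Suc)
    ultimately show "(\<lambda>k. f (m, k)) sums (1 / (2 ^ Suc m - 1))" by simp
  qed (simp add: f_def)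
  have tot: "((\<lambda>m. 1 / (2 ^ Suc m - 1)) has_sum erdos_borwein) UNIV"
    by (rule sums_nonneg_imp_has_sum[OF erdos_borwein_sums]) (simp del: power_Suc)
  have "f summable_on (UNIV \<times> UNIV)"
    by (rule summable_on_SigmaI[OF row]) (use tot in \<open>auto simp: summable_on_def f_def\<close>)
  hence "(f has_sum erdos_borwein) (UNIV \<times> UNIV)"
    using row tot by (intro has_sum_SigmaI)
  also have "?this \<longleftrightarrow> ((\<lambda>(n, j). (1 / 2) ^ Suc n) has_sum erdos_borwein)
      (SIGMA n:UNIV. {j. j dvd Suc n})"
  proof (rule has_sum_reindex_bij_witness[where
        j = "\<lambda>(m, k). (Suc m * Suc k - 1, Suc m)" and i = "\<lambda>(n, j). (j - 1, Suc n div j - 1)"])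
    fix b assume b: "b \<in> (SIGMA n:UNIV. {j. j dvd Suc n})"
    then obtain n j where nj: "b = (n, j)" "j dvd Suc n" by auto
    then obtain c where c: "Suc n = j * c" by (auto elim: dvdE)
    hence "j > 0" "c > 0" by (auto intro!: gr0I)
    thus "(\<lambda>(m, k). (Suc m * Suc k - 1, Suc m)) ((\<lambda>(n, j). (j - 1, Suc n div j - 1)) b) = b"
      using nj c by (simp del: mult_Suc mult_Suc_right)
  qed (auto simp: f_def simp del: mult_Suc mult_Suc_right power_Suc)
  finally have "((\<lambda>n. real (divisor_count (Suc n)) / 2 ^ Suc n) has_sum erdos_borwein) UNIV"
    by (rule has_sum_SigmaD)
      (auto intro!: has_sum_finiteI simp: divisor_count_def power_divide)
  thus ?thesis by (rule has_sum_imp_sums)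
qed

end

theory Submission
  imports Defs "HOL-Number_Theory.Number_Theory" "HOL-Computational_Algebra.Squarefree"
    "HOL-Real_Asymp.Real_Asymp"
begin

text \<open>
  Write \<open>d\<close> for the divisor function. Modulo 1, \<open>2\<^sup>N E\<close> is \<open>\<Sum>j\<ge>1. d(N + j) / 2\<^sup>j\<close>. We look for \<open>N\<close> such that,
  up to a long range \<open>j \<le> L\<close>, every \<open>d(N + j)\<close> is divisible by \<open>2\<^sup>j\<close>, except at one place \<open>K\<close>, where
  \<open>d(N + K) = (2\<^sup>K - 1) w\<close> with \<open>0 < w \<le> 2\<^sup>K / 4\<close>. The term at \<open>K\<close> then contributes \<open>- w / 2\<^sup>K\<close> modulo 1,
  so that \<open>2\<^sup>N E\<close> lies in \<open>[z - 1/4, z)\<close> for an integer \<open>z\<close> once the tail \<open>j > L\<close> is below \<open>2\<^sup>-\<^sup>K\<close>, and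
  the next two digits are 1.

  With \<open>K = 2h\<close>, the number \<open>u = 2^(2^h - 2) * 3^(2^h)\<close> has \<open>2\<^sup>K - 1 = (2^h - 1)(2^h + 1)\<close> divisors while
  \<open>log u\<close> is only of order \<open>2^h\<close>, the square root of \<open>2\<^sup>K\<close>. The Chinese remainder theorem makes \<open>N + K\<close> a
  multiple of \<open>u\<close> with coprime cofactor, and \<open>N + j\<close> a multiple, with coprime cofactor, of a product of
  \<open>j\<close> distinct primes. Since \<open>d\<close> has average order \<open>log N\<close>, also along arithmetic progressions, the
  number \<open>w\<close> (a divisor count of the cofactor) and the tail are small enough for some \<open>N\<close> in the
  resulting residue class.
\<close>

section \<open>Divisor counts\<close>

lemma finite_divisors: "n > 0 \<Longrightarrow> finite {k::nat. k dvd n}"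
  by (rule finite_subset[of _ "{..n}"]) (auto dest: dvd_imp_le)

lemma divisor_count_0 [simp]: "divisor_count 0 = 0"
  by (simp add: divisor_count_def)

lemma divisor_count_pos: "n > 0 \<Longrightarrow> divisor_count n > 0"
  unfolding divisor_count_def by (subst card_gt_0_iff) (auto intro: finite_divisors exI[of _ 1])

lemma divisor_count_le: "divisor_count n \<le> n"
proof (cases "n = 0")
  case False
  hence "{k. k dvd n} \<subseteq> {1..n}"
    by (auto dest: dvd_imp_le intro!: Suc_leI dvd_pos_nat[of n])
  hence "divisor_count n \<le> card {1..n}"
    unfolding divisor_count_def by (intro card_mono) auto
  thus ?thesis by simp
qed simp

lemma divisor_count_mono: "a dvd b \<Longrightarrow> b > 0 \<Longrightarrow> divisor_count a \<le> divisor_count b"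
  unfolding divisor_count_def by (intro card_mono finite_divisors) (auto intro: dvd_trans)

lemma divisors_mult:
  "{k::nat. k dvd a * b} = (\<lambda>(x, y). x * y) ` ({x. x dvd a} \<times> {y. y dvd b})"
proof (intro equalityI subsetI)
  fix k assume "k \<in> {k. k dvd a * b}"
  then obtain x y where "k = x * y" "x dvd a" "y dvd b"
    using division_decomp[of k a b] by auto
  thus "k \<in> (\<lambda>(x, y). x * y) ` ({x. x dvd a} \<times> {y. y dvd b})" by auto
qed (auto intro: mult_dvd_mono)

lemma divisor_count_mult_le: "divisor_count (a * b) \<le> divisor_count a * divisor_count b"
proof (cases "a * b = 0")
  case False
  thus ?thesis
    unfolding divisor_count_def divisors_mult card_cartesian_product[symmetric]
    by (intro card_image_le finite_cartesian_product finite_divisors) auto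
qed auto

lemma divisor_count_mult_coprime:
  assumes "coprime a b"
  shows "divisor_count (a * b) = divisor_count a * divisor_count b"
proof -
  have "inj_on (\<lambda>(x, y). x * y) ({x. x dvd a} \<times> {y. y dvd b})"
  proof (rule inj_onI, clarsimp)
    fix x y x' y' assume *: "x dvd a" "y dvd b" "x' dvd a" "y' dvd b" "x * y = x' * y'"
    have c: "coprime x y'" "coprime x' y" "coprime y x'" "coprime y' x"
      using * assms coprime_divisors by (blast intro: coprime_commute[THEN iffD1])+
    have "x dvd x'" "x' dvd x" "y dvd y'" "y' dvd y"
      using * c by (metis coprime_dvd_mult_left_iff coprime_dvd_mult_right_iff dvd_triv_left dvd_triv_right)+
    thus "x = x' \<and> y = y'" by (auto intro: dvd_antisym)
  qed
  thus ?thesis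
    unfolding divisor_count_def divisors_mult by (simp add: card_image card_cartesian_product)
qed

lemma divisor_count_prime_power:
  assumes "prime p"
  shows "divisor_count (p ^ k) = Suc k"
proof -
  have "{d. d dvd p ^ k} = (\<lambda>i. p ^ i) ` {..k}"
    using divides_primepow_nat[OF assms] by auto
  moreover have "inj_on (\<lambda>i. p ^ i) {..k}"
    using prime_gt_1_nat[OF assms] by (auto intro!: inj_onI)
  ultimately show ?thesis by (simp add: divisor_count_def card_image)
qed

lemma divisor_count_prod_le: "divisor_count (\<Prod>i\<in>A. f i) \<le> (\<Prod>i\<in>A. divisor_count (f i))"
proof (induction A rule: infinite_finite_induct)
  case (insert x F)
  thus ?case using divisor_count_mult_le[of "f x" "prod f F"]
    by (auto intro: order_trans mult_le_mono2)
qed (simp_all add: divisor_count_def)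

lemma divisor_count_prod_primes:
  assumes "finite A" "inj_on f A" "\<And>i. i \<in> A \<Longrightarrow> prime (f i)"
  shows "divisor_count (\<Prod>i\<in>A. f i) = 2 ^ card A"
  using assms
proof (induction A rule: finite_induct)
  case (insert x F)
  have "coprime (f x) (\<Prod>i\<in>F. f i)"
    using insert by (intro prod_coprime_right primes_coprime) auto
  moreover have "divisor_count (f x) = 2"
    using divisor_count_prime_power[of "f x" 1] insert.prems by simp
  ultimately show ?case using insert by (simp add: divisor_count_mult_coprime)
qed (simp add: divisor_count_def)

text \<open>Removing a prime \<open>p\<close> at most halves the divisor count, while
  \<open>P + x \<le> p * x\<close> for \<open>p \<ge> P\<close> and \<open>p, x \<ge> 2\<close>; so
  \<open>P\<close> times the number of prime factors, with multiplicity, is at most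
  \<open>f\<close>. The later use has \<open>P = 4 * L\<close>.\<close>

lemma divisor_count_power_le_of_large_primes:
  assumes "f > 0" "\<And>p. prime p \<Longrightarrow> p dvd f \<Longrightarrow> P \<le> p"
  shows "divisor_count f ^ P \<le> 2 ^ f"
  using assms
proof (induction f rule: prime_divisors_induct)
  case zero
  thus ?case by simp
next
  case (unit x)
  thus ?case by (simp add: divisor_count_def)
next
  case (factor p x)
  have x: "x > 0" using factor.prems by auto
  have IH: "divisor_count x ^ P \<le> 2 ^ x"
    using x factor.prems by (intro factor.IH) auto
  have p: "P \<le> p" using factor by auto
  have dp: "divisor_count p = 2" using divisor_count_prime_power[of p 1] factor.hyps by simp
  show ?case
  proof (cases "x = 1")
    case True
    thus ?thesis using dp p by simp
  next
    case False
    have "divisor_count (p * x) ^ P \<le> (2 * divisor_count x) ^ P"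
      using divisor_count_mult_le[of p x] dp by (intro power_mono) auto
    also have "\<dots> \<le> 2 ^ P * 2 ^ x" using IH by (simp add: power_mult_distrib)
    also have "\<dots> \<le> 2 ^ (p * x)"
    proof -
      obtain a b where "p = a + 2" "x = b + 2"
        using prime_ge_2_nat[OF factor.hyps(1)] x False
        by (metis One_nat_def Suc_leI add.commute le_Suc_ex nat_neq_iff not_less_eq_eq numeral_2_eq_2)
      hence "P + x \<le> p * x" using p by (auto simp: algebra_simps)
      thus ?thesis by (simp flip: power_add)
    qed
    finally show ?thesis .
  qed
qed

section \<open>Averages of the divisor function along arithmetic progressions\<close>

text \<open>Divisors pair off as \<open>e\<close> and \<open>n div e\<close>, and one member of each
  pair is at most \<open>Y\<close>.\<close>

lemma divisor_count_le_small_divisors: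
  assumes "n > 0" "n \<le> Y ^ 2"
  shows "divisor_count n \<le> 2 * card {e\<in>{1..Y}. e dvd n}"
proof -
  let ?S = "{e\<in>{1..Y}. e dvd n}"
  have "{k. k dvd n} \<subseteq> ?S \<union> (\<lambda>e. n div e) ` ?S"
  proof
    fix k assume "k \<in> {k. k dvd n}"
    then obtain m where m: "n = k * m" by auto
    hence pos: "k > 0" "m > 0" using assms by auto
    show "k \<in> ?S \<union> (\<lambda>e. n div e) ` ?S"
    proof (cases "k \<le> Y")
      case True
      thus ?thesis using pos m by auto
    next
      case False
      have "m \<le> Y"
      proof (rule ccontr)
        assume "\<not> m \<le> Y"
        with False have "Y * Y < k * m" by (intro mult_strict_mono) auto
        thus False using assms m by (simp add: power2_eq_square)
      qed
      hence "m \<in> ?S" "k = n div m" using m pos by auto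
      thus ?thesis by blast
    qed
  qed
  hence "divisor_count n \<le> card (?S \<union> (\<lambda>e. n div e) ` ?S)"
    unfolding divisor_count_def by (intro card_mono) auto
  also have "\<dots> \<le> card ?S + card ?S"
    by (intro order_trans[OF card_Un_le] add_mono card_image_le) auto
  finally show ?thesis by simp
qed

text \<open>If a solution exists, a common divisor of \<open>e\<close> and \<open>m\<close> also
  divides \<open>c\<close>, so \<open>e\<close> is coprime to \<open>m\<close>. The solutions then
  lie in one class mod \<open>e\<close>, at most one in each block of length
  \<open>e\<close>.\<close>

lemma card_multiples_progression_le:
  fixes c m e X :: nat
  assumes "coprime c m" "e > 0"
  shows "card {t\<in>{..<X}. e dvd c + m * t} \<le> X div e + 1"
proof -
  let ?T = "{t\<in>{..<X}. e dvd c + m * t}"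
  have "inj_on (\<lambda>t. t div e) ?T"
  proof (rule inj_onI)
    fix s t assume s: "s \<in> ?T" and t: "t \<in> ?T" and eq: "s div e = t div e"
    have "coprime e m"
    proof (rule coprimeI)
      fix d assume d: "d dvd e" "d dvd m"
      hence "d dvd c + m * s" using s by (auto intro: dvd_trans)
      hence "d dvd c" using d(2) by (simp add: dvd_add_left_iff)
      thus "is_unit d" using d(2) assms(1) coprime_common_divisor by blast
    qed
    moreover have "[c + m * s = c + m * t] (mod e)"
      using s t by (auto simp: cong_def dvd_eq_mod_eq_0)
    ultimately have "[s = t] (mod e)"
      by (simp add: cong_add_lcancel_nat cong_mult_lcancel_nat coprime_commute)
    thus "s = t" using eq by (metis cong_def mult_div_mod_eq)
  qed
  hence "card ?T = card ((\<lambda>t. t div e) ` ?T)" by (simp add: card_image)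
  also have "\<dots> \<le> card {..X div e}"
    by (intro card_mono) (auto intro: div_le_mono)
  finally show ?thesis by simp
qed

text \<open>Each dyadic block has \<open>2 ^ y\<close> terms of size at most
  \<open>1 / 2 ^ y\<close>, so it adds at most 1.\<close>

lemma harm_two_power_le: "harm (2 ^ y) \<le> real y + 1"
proof (induction y)
  case 0
  show ?case by (simp add: harm_def)
next
  case (Suc y)
  have "harm (2 ^ Suc y) = harm (2 ^ y) + (\<Sum>k\<in>{2^y<..2^Suc y}. inverse (real k))"
    unfolding harm_def by (subst sum.union_disjoint[symmetric]) (auto intro!: sum.cong)
  also have "(\<Sum>k\<in>{2^y<..2^Suc y}. inverse (real k)) \<le> (\<Sum>k\<in>{2^y<..2^Suc y::nat}. inverse (2 ^ y))"
  proof (intro sum_mono le_imp_inverse_le)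
    fix k :: nat assume "k \<in> {2^y<..2^Suc y}"
    hence "2 ^ y \<le> k" by simp
    hence "real (2 ^ y) \<le> real k" by (rule of_nat_mono)
    thus "2 ^ y \<le> real k" by simp
  qed auto
  also have "\<dots> = 1" by simp
  finally show ?case using Suc.IH by simp
qed

text \<open>All terms are at most \<open>(2 ^ y) ^ 2\<close>, so counting divisors up to
  \<open>2 ^ y\<close> suffices up to a factor 2. Exchanging the sums leaves a harmonic sum plus an
  error of 1 per divisor, which totals only \<open>2 ^ y\<close> because cutoff and length
  agree.\<close>

lemma sum_divisor_count_progression_le:
  fixes c m y :: nat
  assumes "coprime c m" "c > 0" "c + m * 2 ^ y \<le> 2 ^ (2 * y)"
  shows "(\<Sum>t<2^y. real (divisor_count (c + m * t))) \<le> 2 ^ y * (2 * real y + 4)"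
proof -
  define X :: nat where "X = 2 ^ y"
  have "(\<Sum>t<X. divisor_count (c + m * t)) \<le> (\<Sum>t<X. 2 * (\<Sum>e\<in>{1..X}. if e dvd c + m * t then 1 else 0))"
  proof (intro sum_mono)
    fix t assume "t \<in> {..<X}"
    hence "c + m * t \<le> c + m * X" by (intro add_mono mult_le_mono) auto
    also have "\<dots> \<le> X ^ 2"
      using assms(3) by (simp add: X_def power_mult[symmetric] mult.commute)
    finally have "c + m * t \<le> X ^ 2" .
    hence "divisor_count (c + m * t) \<le> 2 * card {e\<in>{1..X}. e dvd c + m * t}"
      using assms(2) by (intro divisor_count_le_small_divisors) auto
    also have "card {e\<in>{1..X}. e dvd c + m * t} = (\<Sum>e\<in>{1..X}. if e dvd c + m * t then 1 else 0)"
      by (simp add: sum.If_cases Int_def)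
    finally show "divisor_count (c + m * t) \<le> 2 * (\<Sum>e\<in>{1..X}. if e dvd c + m * t then 1 else 0)" .
  qed
  also have "\<dots> = 2 * (\<Sum>e\<in>{1..X}. card {t\<in>{..<X}. e dvd c + m * t})"
    unfolding sum_distrib_left[symmetric] by (subst sum.swap) (simp add: sum.If_cases Int_def)
  also have "\<dots> \<le> 2 * (\<Sum>e\<in>{1..X}. X div e + 1)"
    using assms(1) by (intro mult_le_mono2 sum_mono card_multiples_progression_le) auto
  finally have "real (\<Sum>t<X. divisor_count (c + m * t)) \<le> real (2 * (\<Sum>e\<in>{1..X}. X div e + 1))"
    by (rule of_nat_mono)
  also have "\<dots> = 2 * (\<Sum>e\<in>{1..X}. real (X div e) + 1)"
    by (simp add: add.commute)
  also have "\<dots> \<le> 2 * (\<Sum>e\<in>{1..X}. real X * inverse (real e) + 1)"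
  proof -
    have "real (X div e) \<le> real X * inverse (real e)" for e
      using of_nat_div_le_of_nat[of X e, where ?'a = real] by (simp add: divide_inverse)
    thus ?thesis by (intro mult_left_mono sum_mono add_mono) auto
  qed
  also have "\<dots> = 2 * (real X * harm X + real X)"
    by (simp add: sum.distrib sum_distrib_left harm_def)
  also have "\<dots> \<le> 2 * (real X * (real y + 1) + real X)"
    using harm_two_power_le[of y] by (intro mult_left_mono add_mono) (auto simp: X_def)
  finally show ?thesis by (simp add: X_def algebra_simps)
qed

section \<open>An upper bound for the n-th prime\<close>

text \<open>Every \<open>n \<le> 4\<^sup>k\<close> is a product of distinct primes times the square of a number at most \<open>2\<^sup>k\<close>.\<close>

lemma card_primes_le_4_power: "card {p::nat. prime p \<and> p \<le> 4 ^ k} \<ge> k"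
proof -
  let ?P = "{p::nat. prime p \<and> p \<le> 4 ^ k}"
  have fin: "finite ?P" by (rule finite_subset[of _ "{..4^k}"]) auto
  have "{1..4 ^ k} \<subseteq> (\<lambda>(S, m). \<Prod>S * m ^ 2) ` (Pow ?P \<times> {1..2 ^ k})"
  proof
    fix n :: nat assume n: "n \<in> {1..4 ^ k}"
    define s m :: nat where "s = squarefree_part n" and "m = square_part n"
    have nsm: "n = s * m ^ 2" unfolding s_def m_def by (rule squarefree_decompose)
    have pos: "s > 0" "m > 0" using n nsm by (auto intro!: gr0I)
    have "m ^ 2 \<le> n" using nsm pos by simp
    also have "n \<le> (2 ^ k) ^ 2" using n by (simp add: power2_eq_square power_mult_distrib[symmetric])
    finally have "m \<le> 2 ^ k" by (rule power2_le_imp_le) simp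
    have "s dvd n" using nsm by simp
    hence "s \<le> 4 ^ k" using n by (auto dest!: dvd_imp_le)
    hence "prime_factors s \<subseteq> ?P" using pos
      by (auto simp: prime_factors_dvd dest!: dvd_imp_le)
    moreover have "s = \<Prod>(prime_factors s)"
    proof -
      have "squarefree s" unfolding s_def by simp
      hence "\<forall>p\<in>prime_factors s. multiplicity p s = 1"
        using squarefree_factorial_semiring' pos by blast
      moreover have "s = (\<Prod>p\<in>prime_factors s. p ^ multiplicity p s)"
        using pos by (intro prime_factorization_nat)
      ultimately show ?thesis by (metis (no_types, lifting) power_one_right prod.cong)
    qed
    ultimately have "(prime_factors s, m) \<in> Pow ?P \<times> {1..2 ^ k}"
      "n = (\<lambda>(S, m). \<Prod>S * m ^ 2) (prime_factors s, m)"
      using nsm pos \<open>m \<le> 2 ^ k\<close> by auto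
    thus "n \<in> (\<lambda>(S, m). \<Prod>S * m ^ 2) ` (Pow ?P \<times> {1..2 ^ k})" by blast
  qed
  \<comment> \<open>Counting the pairs gives \<open>4 ^ k \<le> 2 ^ card ?P * 2 ^ k\<close>, and
    cancelling \<open>2 ^ k\<close> leaves the claim.\<close>
  hence "card {1..4 ^ k::nat} \<le> card ((\<lambda>(S, m). \<Prod>S * m ^ 2) ` (Pow ?P \<times> {1..2 ^ k::nat}))"
    using fin by (intro card_mono) auto
  also have "\<dots> \<le> card (Pow ?P \<times> {1..2 ^ k::nat})"
    using fin by (intro card_image_le) auto
  also have "\<dots> = 2 ^ card ?P * 2 ^ k"
    using fin by (simp add: card_cartesian_product card_Pow)
  finally have "(2::nat) ^ (k + k) \<le> 2 ^ (card ?P + k)"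
    by (simp add: power_add power_mult_distrib[symmetric])
  thus ?thesis by (simp add: power_le_imp_le_exp)
qed

text \<open>Otherwise the primes up to \<open>4 ^ Suc n\<close> would all be among the first
  \<open>n\<close>, although there are at least \<open>n + 1\<close> of them; the enumeration starts
  at index 0.\<close>

lemma enumerate_primes_le: "enumerate {p::nat. prime p} n \<le> 4 ^ Suc n"
proof (rule ccontr)
  let ?S = "{p::nat. prime p}"
  assume less: "\<not> enumerate ?S n \<le> 4 ^ Suc n"
  have "{p::nat. prime p \<and> p \<le> 4 ^ Suc n} \<subseteq> enumerate ?S ` {..<n}"
  proof
    fix p :: nat assume p: "p \<in> {p::nat. prime p \<and> p \<le> 4 ^ Suc n}"
    then obtain m where m: "enumerate ?S m = p" using enumerate_Ex[OF primes_infinite] by auto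
    hence "enumerate ?S m < enumerate ?S n" using p less by auto
    hence "m < n" using primes_infinite by simp
    thus "p \<in> enumerate ?S ` {..<n}" using m by auto
  qed
  hence "card {p::nat. prime p \<and> p \<le> 4 ^ Suc n} \<le> card (enumerate ?S ` {..<n})"
    by (intro card_mono) auto
  also have "\<dots> \<le> n" using card_image_le[of "{..<n}" "enumerate ?S"] by simp
  finally show False using card_primes_le_4_power[of "Suc n"] by linarith
qed

section \<open>Coprime cofactors, gcds of products, and growth estimates\<close>

text \<open>A congruence mod \<open>r\<close> yields only \<open>r dvd n\<close>; mod
  \<open>r ^ 2\<close> it forces the cofactor to be 1 mod \<open>r\<close>, so that the divisor
  count factors.\<close>

lemma cong_self_mod_square_imp_coprime_factor:
  fixes n r :: nat
  assumes "[n = r] (mod r ^ 2)" "r > 0"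
  obtains v where "n = r * v" "coprime r v"
proof -
  have "[n = r] (mod r)"
    using assms(1) by (rule cong_dvd_modulus_nat) (simp add: power2_eq_square)
  hence "r dvd n" by (simp add: cong_def dvd_eq_mod_eq_0)
  then obtain v where v: "n = r * v" by auto
  have "[r * v = r * 1] (mod r * r)"
    using assms(1) v by (simp add: power2_eq_square)
  hence "[v = 1] (mod r)"
    using assms(2) unfolding cong_def by (metis mult_left_cancel mult_mod_right not_less0)
  hence "coprime r v" by (metis cong_imp_coprime cong_sym coprime_1_left coprime_commute)
  with v that show ?thesis by blast
qed

lemma gcd_mult_dvd_mult_gcd: "gcd x (a * b) dvd gcd x a * gcd x (b::nat)"
proof -
  obtain a' b' where "gcd x (a * b) = a' * b'" "a' dvd a" "b' dvd b"
    using division_decomp[of "gcd x (a * b)" a b] by auto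
  moreover from this have "a' dvd x" "b' dvd x"
    by (metis dvd_mult_left dvd_mult_right gcd_dvd1)+
  ultimately show ?thesis by (metis gcd_greatest mult_dvd_mono)
qed

lemma gcd_prod_dvd_prod_gcd: "gcd x (\<Prod>i\<in>A. f i) dvd (\<Prod>i\<in>A. gcd x (f i :: nat))"
proof (induction A rule: infinite_finite_induct)
  case (insert i F)
  have "gcd x (f i * prod f F) dvd gcd x (f i) * gcd x (prod f F)"
    by (rule gcd_mult_dvd_mult_gcd)
  also have "\<dots> dvd gcd x (f i) * (\<Prod>i\<in>F. gcd x (f i))"
    using insert.IH by (rule mult_dvd_mono[OF dvd_refl])
  finally show ?case using insert.hyps by simp
qed auto

text \<open>Uses \<open>2 \<le> 9 / 4\<close>. The base \<open>3 / 2\<close> lies below 2, so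
  dividing by \<open>2 ^ j\<close> leaves a convergent geometric series in
  \<open>3 / 4\<close>.\<close>

lemma of_nat_le_three_halves_power:
  fixes D :: nat
  assumes "D ^ 2 \<le> 2 ^ j"
  shows "real D \<le> (3 / 2) ^ j"
proof (rule power2_le_imp_le)
  have "real D ^ 2 = real (D ^ 2)" by simp
  also have "\<dots> \<le> real (2 ^ j)" using assms by (rule of_nat_mono)
  also have "\<dots> \<le> (9 / 4) ^ j" by (auto intro: power_mono)
  also have "\<dots> = ((3 / 2) ^ j) ^ 2" by (simp add: power2_eq_square power_mult_distrib[symmetric])
  finally show "real D ^ 2 \<le> ((3 / 2) ^ j) ^ 2" .
qed simp

text \<open>Serves the places so far out that the trivial bound by \<open>n\<close> on the divisor
  count is enough. From 10 on, one step multiplies the square by at most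
  \<open>3 / 2\<close>.\<close>

lemma square_le_three_halves_power:
  assumes "j \<ge> 10"
  shows "real j ^ 2 \<le> 2 * (3 / 2) ^ j"
  using assms
proof (induction j rule: nat_induct_at_least)
  case base
  show ?case by (simp add: power_divide)
next
  case (Suc n)
  have "real (Suc n) ^ 2 = real n ^ 2 + 2 * real n + 1" by (simp add: power2_eq_square algebra_simps)
  also have "2 * real n + 1 \<le> real n * real n / 2"
  proof -
    have "10 * real n \<le> real n * real n" using Suc.hyps by (intro mult_right_mono) auto
    thus ?thesis using Suc.hyps by linarith
  qed
  hence "real n ^ 2 + 2 * real n + 1 \<le> (3 / 2) * real n ^ 2" by (simp add: power2_eq_square)
  also have "\<dots> \<le> (3 / 2) * (2 * (3 / 2) ^ n)" using Suc.IH by (intro mult_left_mono) auto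
  finally show ?case by simp
qed

text \<open>Dividing out the gcd reduces to the coprime case; submultiplicativity pays for it with
  one factor.\<close>

lemma sum_divisor_count_progression_le_gcd:
  fixes c m y :: nat
  assumes "c > 0" "c + m * 2 ^ y \<le> 2 ^ (2 * y)"
  shows "(\<Sum>t<2^y. real (divisor_count (c + m * t)))
    \<le> real (divisor_count (gcd c m)) * (2 ^ y * (2 * real y + 4))"
proof -
  define g c' m' where "g = gcd c m" and "c' = c div g" and "m' = m div g"
  have g: "g > 0" "c = g * c'" "m = g * m'" using assms by (auto simp: g_def c'_def m'_def)
  have cop: "coprime c' m'" unfolding c'_def m'_def g_def using assms by (intro div_gcd_coprime) auto
  have "c' + m' * 2 ^ y \<le> g * (c' + m' * 2 ^ y)" using g(1) by simp
  also have "\<dots> = c + m * 2 ^ y" using g(2,3) by (simp add: algebra_simps)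
  finally have le: "c' + m' * 2 ^ y \<le> 2 ^ (2 * y)" using assms(2) by linarith
  have "(\<Sum>t<2^y. real (divisor_count (c + m * t)))
      \<le> (\<Sum>t<2^y. real (divisor_count g) * real (divisor_count (c' + m' * t)))"
  proof (intro sum_mono)
    fix t
    have "c + m * t = g * (c' + m' * t)" using g(2,3) by (simp add: algebra_simps)
    hence "divisor_count (c + m * t) \<le> divisor_count g * divisor_count (c' + m' * t)"
      using divisor_count_mult_le by simp
    thus "real (divisor_count (c + m * t)) \<le> real (divisor_count g) * real (divisor_count (c' + m' * t))"
      by (metis of_nat_le_iff of_nat_mult)
  qed
  also have "\<dots> = real (divisor_count g) * (\<Sum>t<2^y. real (divisor_count (c' + m' * t)))"
    by (simp add: sum_distrib_left)
  also have "\<dots> \<le> real (divisor_count g) * (2 ^ y * (2 * real y + 4))"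
    using cop le g(2) assms(1)
    by (intro mult_left_mono sum_divisor_count_progression_le) (auto intro!: gr0I)
  finally show ?thesis by (simp add: g_def)
qed

section \<open>From divisor counts to binary digits\<close>

lemma divisor_count_sums: "(\<lambda>n. real (divisor_count n) / 2 ^ n) sums erdos_borwein"
  using erdos_borwein_sums_divisor_count
    sums_Suc_iff[of "\<lambda>n. real (divisor_count n) / 2 ^ n" erdos_borwein] by simp

lemma summable_divisor_count_shift: "summable (\<lambda>j. real (divisor_count (N + (k + j))) / 2 ^ (k + j))"
proof -
  have "summable (\<lambda>n. real (divisor_count n) / 2 ^ n)"
    using divisor_count_sums by (simp add: sums_iff)
  hence "summable (\<lambda>j. 2 ^ N * (real (divisor_count (j + (N + k))) / 2 ^ (j + (N + k))))"
    by (intro summable_mult) (subst summable_iff_shift)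
  thus ?thesis by (simp add: power_add add_ac)
qed

text \<open>The terms up to \<open>N\<close> become an integer, the window \<open>1..L\<close> is
  controlled by divisibility, and the tail is left to averaging.\<close>

lemma two_power_mult_erdos_borwein:
  "2 ^ N * erdos_borwein = real (\<Sum>n\<le>N. divisor_count n * 2 ^ (N - n))
     + (\<Sum>j=1..L. real (divisor_count (N + j)) / 2 ^ j)
     + (\<Sum>j. real (divisor_count (N + (Suc L + j))) / 2 ^ (Suc L + j))"
proof -
  let ?f = "\<lambda>n. real (divisor_count n) / 2 ^ n"
  have sm: "summable ?f" and E: "erdos_borwein = suminf ?f"
    using divisor_count_sums by (auto simp: sums_iff)
  have "erdos_borwein = (\<Sum>j. ?f (j + (N + Suc L))) + (\<Sum>n<N + Suc L. ?f n)"
    unfolding E by (rule suminf_split_initial_segment[OF sm])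
  also have "{..<N + Suc L} = {..N} \<union> (\<lambda>j. N + j) ` {1..L}"
  proof (intro equalityI subsetI)
    fix n assume n: "n \<in> {..<N + Suc L}"
    show "n \<in> {..N} \<union> (\<lambda>j. N + j) ` {1..L}"
    proof (cases "n \<le> N")
      case False
      hence "n = N + (n - N)" "n - N \<in> {1..L}" using n by auto
      thus ?thesis by blast
    qed auto
  qed auto
  also have "(\<Sum>n\<in>{..N} \<union> (\<lambda>j. N + j) ` {1..L}. ?f n) = (\<Sum>n\<le>N. ?f n) + (\<Sum>j=1..L. ?f (N + j))"
  proof (subst sum.union_disjoint)
    show "(\<Sum>n\<le>N. ?f n) + sum ?f ((\<lambda>j. N + j) ` {1..L}) = (\<Sum>n\<le>N. ?f n) + (\<Sum>j=1..L. ?f (N + j))"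
      by (subst sum.reindex) (simp_all add: o_def)
  qed auto
  finally have split: "erdos_borwein = (\<Sum>j. ?f (j + (N + Suc L)))
      + ((\<Sum>n\<le>N. ?f n) + (\<Sum>j=1..L. ?f (N + j)))" .
  have "2 ^ N * erdos_borwein = 2 ^ N * (\<Sum>n\<le>N. ?f n) + 2 ^ N * (\<Sum>j=1..L. ?f (N + j))
      + 2 ^ N * (\<Sum>j. ?f (j + (N + Suc L)))"
    unfolding split by (simp only: distrib_left add_ac)
  also have "2 ^ N * (\<Sum>n\<le>N. ?f n) = real (\<Sum>n\<le>N. divisor_count n * 2 ^ (N - n))"
    unfolding of_nat_sum sum_distrib_left
  proof (intro sum.cong refl)
    fix n assume "n \<in> {..N}"
    hence "(2::real) ^ N = 2 ^ n * 2 ^ (N - n)" by (simp flip: power_add)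
    thus "2 ^ N * ?f n = real (divisor_count n * 2 ^ (N - n))" by simp
  qed
  also have "2 ^ N * (\<Sum>j=1..L. ?f (N + j)) = (\<Sum>j=1..L. real (divisor_count (N + j)) / 2 ^ j)"
    unfolding sum_distrib_left by (intro sum.cong) (auto simp: power_add)
  also have "2 ^ N * (\<Sum>j. ?f (j + (N + Suc L)))
      = (\<Sum>j. 2 ^ N * ?f (j + (N + Suc L)))"
    by (intro suminf_mult[symmetric]) (use sm in \<open>subst summable_iff_shift\<close>)
  also have "(\<lambda>j. 2 ^ N * ?f (j + (N + Suc L)))
      = (\<lambda>j. real (divisor_count (N + (Suc L + j))) / 2 ^ (Suc L + j))"
    by (simp add: power_add add_ac fun_eq_iff)
  finally show ?thesis .
qed

text \<open>The fractional part lies in \<open>[3/4, 1)\<close>, the numbers whose first two digits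
  are 1.\<close>

lemma binary_digits_11I:
  assumes "of_int z - 1 / 4 \<le> 2 ^ N * x" "2 ^ N * x < of_int z"
  shows "binary_digit x (N + 1) = 1" "binary_digit x (N + 2) = 1"
proof -
  have "\<lfloor>2 ^ (N + 1) * x\<rfloor> = 2 * z - 1" using assms by (simp add: floor_eq_iff)
  thus "binary_digit x (N + 1) = 1" unfolding binary_digit_def by presburger
  have "\<lfloor>2 ^ (N + 2) * x\<rfloor> = 4 * z - 1" using assms by (simp add: floor_eq_iff)
  thus "binary_digit x (N + 2) = 1" unfolding binary_digit_def by presburger
qed

lemma erdos_borwein_digits_11:
  fixes N K L w :: nat
  assumes K: "K \<in> {1..L}"
    and dvd: "\<And>j. j \<in> {1..L} - {K} \<Longrightarrow> 2 ^ j dvd divisor_count (N + j)"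
    and dK: "divisor_count (N + K) = (2 ^ K - 1) * w"
    and w: "w > 0" "4 * w \<le> 2 ^ K"
    and tail: "2 ^ K * (\<Sum>j. real (divisor_count (N + (Suc L + j))) / 2 ^ (Suc L + j)) < 1"
  shows "binary_digit erdos_borwein (N + 1) = 1" "binary_digit erdos_borwein (N + 2) = 1"
proof -
  define T where "T = (\<Sum>j. real (divisor_count (N + (Suc L + j))) / 2 ^ (Suc L + j))"
  \<comment> \<open>\<open>z\<close> collects every integer contribution; the final \<open>w\<close>
    comes from \<open>(2 ^ K - 1) * w / 2 ^ K = w - w / 2 ^ K\<close>.\<close>
  define z :: nat where "z = (\<Sum>n\<le>N. divisor_count n * 2 ^ (N - n))
    + (\<Sum>j\<in>{1..L} - {K}. divisor_count (N + j) div 2 ^ j) + w"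
  have "(\<Sum>j=1..L. real (divisor_count (N + j)) / 2 ^ j) = real (divisor_count (N + K)) / 2 ^ K
      + (\<Sum>j\<in>{1..L} - {K}. real (divisor_count (N + j)) / 2 ^ j)"
    using K by (intro sum.remove) auto
  also have "(\<Sum>j\<in>{1..L} - {K}. real (divisor_count (N + j)) / 2 ^ j)
      = real (\<Sum>j\<in>{1..L} - {K}. divisor_count (N + j) div 2 ^ j)"
    unfolding of_nat_sum using dvd by (intro sum.cong) (auto simp: real_of_nat_div)
  also have "real (divisor_count (N + K)) / 2 ^ K = real w - real w / 2 ^ K"
    unfolding dK by (simp add: of_nat_diff field_simps)
  finally have eq: "2 ^ N * erdos_borwein = real z - real w / 2 ^ K + T"
    unfolding two_power_mult_erdos_borwein[of N L] T_def z_def by simp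
  have "T \<ge> 0" unfolding T_def by (intro suminf_nonneg summable_divisor_count_shift) auto
  \<comment> \<open>As \<open>w \<ge> 1\<close>, a tail below \<open>1 / 2 ^ K\<close> cannot lift
    the value up to \<open>z\<close>.\<close>
  moreover have "T < real w / 2 ^ K"
  proof -
    have "2 ^ K * T < real w" using tail w(1) by (simp add: T_def)
    thus ?thesis by (simp add: field_simps)
  qed
  moreover have "real w / 2 ^ K \<le> 1 / 4"
  proof -
    have "real (4 * w) \<le> real (2 ^ K)" using w(2) by (rule of_nat_mono)
    thus ?thesis by (simp add: field_simps)
  qed
  ultimately have "of_int (int z) - 1 / 4 \<le> 2 ^ N * erdos_borwein"
    "2 ^ N * erdos_borwein < of_int (int z)"
    unfolding eq of_int_of_nat_eq by linarith+
  thus "binary_digit erdos_borwein (N + 1) = 1" "binary_digit erdos_borwein (N + 2) = 1"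
    by (rule binary_digits_11I)+
qed

section \<open>Averaging over a residue class\<close>

text \<open>\<open>R i\<close> is the divisor prescribed for \<open>a + i\<close>, and the
  congruence mod \<open>R i ^ 2\<close> makes its cofactor coprime. Primes from \<open>4 * L\<close>
  on divide no difference of distinct window indices and rarely divide later ones.
  \<open>2 ^ y\<close> is both the number of terms averaged and the divisor cutoff.\<close>

locale residue_system =
  fixes R :: "nat \<Rightarrow> nat" and L K a M y :: nat
  assumes K: "K \<in> {1..L}"
    and R_pos: "\<And>i. i \<in> {1..L} \<Longrightarrow> R i > 0"
    and R_primes: "\<And>i p. i \<in> {1..L} - {K} \<Longrightarrow> prime p \<Longrightarrow> p dvd R i \<Longrightarrow> 4 * L \<le> p"
    and R_cong: "\<And>i. i \<in> {1..L} \<Longrightarrow> [a + i = R i] (mod R i ^ 2)"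
    and M_eq: "M = (\<Prod>i=1..L. R i ^ 2)"
    and a_less: "a < M"
    and M_le: "2 * M \<le> 2 ^ y"
    and K_le: "K \<le> 2 ^ y"
    and y_ge: "4 \<le> y"
begin

lemma R_dvd: "i \<in> {1..L} \<Longrightarrow> R i dvd a + i"
  using cong_self_mod_square_imp_coprime_factor[OF R_cong R_pos] by (metis dvd_triv_left)

text \<open>Keeps the progression below \<open>(2 ^ y) ^ 2\<close>, the range where the averages
  apply.\<close>

lemma progression_le:
  assumes "j \<le> 2 ^ y"
  shows "a + j + M * 2 ^ y \<le> 2 ^ (2 * y)"
proof -
  have "a + j \<le> a * 2 ^ y + 2 ^ y" using assms by (intro add_mono) auto
  also have "\<dots> = (a + 1) * 2 ^ y" by simp
  also have "\<dots> \<le> M * 2 ^ y" using a_less by (intro mult_right_mono) auto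
  finally have "a + j + M * 2 ^ y \<le> (2 * M) * 2 ^ y" by simp
  also have "\<dots> \<le> 2 ^ y * 2 ^ y" using M_le by (rule mult_right_mono) simp
  finally show ?thesis by (simp add: mult_2 power_add)
qed

text \<open>
  A prime dividing both \<open>a + j\<close> and \<open>R i\<close>, \<open>i \<noteq> K\<close>, divides \<open>j - i\<close> and is at least \<open>4 L\<close>, so there are few of
  them. The factor at \<open>K\<close> is bounded trivially.
\<close>

lemma divisor_count_gcd_modulus_le:
  assumes "j > L"
  shows "real (divisor_count (gcd (a + j) M)) \<le> real (divisor_count (R K ^ 2)) * (3 / 2) ^ j"
proof -
  let ?I = "{1..L} - {K}"
  define f where "f = (\<lambda>i. gcd (j - i) (R i))"
  define D where "D = (\<Prod>i\<in>?I. divisor_count (f i) ^ 2)"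
  have L: "L > 0" using K by auto
  have gcd_le: "divisor_count (gcd (a + j) (R i ^ 2)) \<le> divisor_count (f i) ^ 2" if i: "i \<in> ?I" for i
  proof -
    obtain q where q: "a + i = R i * q" using R_dvd[of i] i by (auto elim: dvdE)
    have "a + j = R i * q + (j - i)" using q i assms by auto
    hence "gcd (a + j) (R i) = f i"
      unfolding f_def by (metis add.commute gcd.commute gcd_add_mult mult.commute)
    hence "gcd (a + j) (R i ^ 2) dvd f i * f i"
      using gcd_mult_dvd_mult_gcd[of "a + j" "R i" "R i"] by (simp add: power2_eq_square)
    moreover have "f i > 0" using i assms by (auto simp: f_def)
    ultimately have "divisor_count (gcd (a + j) (R i ^ 2)) \<le> divisor_count (f i * f i)"
      by (intro divisor_count_mono) auto
    also have "\<dots> \<le> divisor_count (f i) ^ 2"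
      using divisor_count_mult_le by (simp add: power2_eq_square)
    finally show ?thesis .
  qed
  have f_le: "divisor_count (f i) ^ (4 * L) \<le> 2 ^ j" if i: "i \<in> ?I" for i
  proof -
    have "divisor_count (f i) ^ (4 * L) \<le> 2 ^ f i"
      using i assms R_primes[OF i]
      by (intro divisor_count_power_le_of_large_primes) (auto simp: f_def)
    also have "f i \<le> j - i" using i assms unfolding f_def by (intro gcd_le1_nat) auto
    hence "(2::nat) ^ f i \<le> 2 ^ j" by (intro power_increasing) auto
    finally show ?thesis .
  qed
  \<comment> \<open>The threshold \<open>4 * L\<close> pays off here: fewer than or exactly
    \<open>L\<close> factors, each with \<open>4 * L\<close>-th power at most \<open>2 ^ j\<close>,
    give \<open>D ^ 2 \<le> 2 ^ j\<close> after taking roots.\<close>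
  have "(D ^ 2) ^ (2 * L) = (\<Prod>i\<in>?I. divisor_count (f i) ^ (4 * L)) ^ 2"
    unfolding D_def by (simp add: prod_power_distrib[symmetric] power_mult[symmetric] mult_ac)
  also have "\<dots> \<le> (\<Prod>i\<in>?I. 2 ^ j) ^ 2"
    using f_le by (intro power_mono prod_mono) auto
  also have "\<dots> = (2 ^ j) ^ (2 * card ?I)" by (simp add: power_mult[symmetric] mult_ac)
  also have "\<dots> \<le> (2 ^ j) ^ (2 * L)"
    by (intro power_increasing) (auto intro: order_trans[OF card_Diff1_le])
  finally have "D ^ 2 \<le> 2 ^ j" using L by (subst (asm) power_mono_iff) auto
  hence D: "real D \<le> (3 / 2) ^ j" by (rule of_nat_le_three_halves_power)
  have "divisor_count (gcd (a + j) M) \<le> divisor_count (\<Prod>i=1..L. gcd (a + j) (R i ^ 2))"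
    unfolding M_eq using R_pos by (intro divisor_count_mono gcd_prod_dvd_prod_gcd) (auto intro!: prod_pos)
  also have "\<dots> \<le> (\<Prod>i=1..L. divisor_count (gcd (a + j) (R i ^ 2)))"
    by (rule divisor_count_prod_le)
  also have "\<dots> = divisor_count (gcd (a + j) (R K ^ 2)) * (\<Prod>i\<in>?I. divisor_count (gcd (a + j) (R i ^ 2)))"
    using K by (intro prod.remove) auto
  also have "\<dots> \<le> divisor_count (R K ^ 2) * D"
    unfolding D_def using gcd_le R_pos[OF K]
    by (intro mult_le_mono prod_mono divisor_count_mono) auto
  finally have "real (divisor_count (gcd (a + j) M)) \<le> real (divisor_count (R K ^ 2) * D)"
    by (rule of_nat_mono)
  also have "\<dots> \<le> real (divisor_count (R K ^ 2)) * (3 / 2) ^ j"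
    using D by (simp add: mult_left_mono)
  finally show ?thesis .
qed

text \<open>Up to \<open>j = 2 ^ y\<close> the average over the progression applies, with the gcd as
  loss. Beyond, every term is at most \<open>2 * j ^ 2\<close>, so the trivial bound wins.\<close>

lemma sum_divisor_count_shift_le:
  assumes "j > L"
  shows "(\<Sum>t<2^y. real (divisor_count (a + M * t + j)))
    \<le> real (divisor_count (R K ^ 2)) * (2 ^ y * (2 * real y + 4)) * (3 / 2) ^ j"
proof (cases "j \<le> 2 ^ y")
  case True
  have "(\<Sum>t<2^y. real (divisor_count (a + M * t + j))) = (\<Sum>t<2^y. real (divisor_count (a + j + M * t)))"
    by (simp add: add_ac)
  also have "\<dots> \<le> real (divisor_count (gcd (a + j) M)) * (2 ^ y * (2 * real y + 4))"
    using assms progression_le[OF True] by (intro sum_divisor_count_progression_le_gcd) auto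
  also have "\<dots> \<le> (real (divisor_count (R K ^ 2)) * (3 / 2) ^ j) * (2 ^ y * (2 * real y + 4))"
    using divisor_count_gcd_modulus_le[OF assms] by (intro mult_right_mono) auto
  finally show ?thesis by (simp add: mult_ac)
next
  case False
  have j16: "16 \<le> j"
  proof -
    have "(2::nat) ^ 4 \<le> 2 ^ y" using y_ge by (intro power_increasing) auto
    thus ?thesis using False by simp
  qed
  have "(\<Sum>t<2^y. real (divisor_count (a + M * t + j))) \<le> (\<Sum>t<2^y::nat. 4 * (3 / 2) ^ j)"
  proof (intro sum_mono)
    fix t :: nat assume t: "t \<in> {..<2 ^ y}"
    have "divisor_count (a + M * t + j) \<le> a + M * t + j" by (rule divisor_count_le)
    also have "\<dots> \<le> a + M * 2 ^ y + j" using t by (intro add_mono mult_le_mono) auto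
    also have "\<dots> \<le> 2 ^ (2 * y) + j" using progression_le[of 0] by simp
    also have "\<dots> \<le> j ^ 2 + j ^ 2"
    proof (rule add_mono)
      have "((2::nat) ^ y) ^ 2 \<le> j ^ 2" using False by (intro power_mono) auto
      thus "2 ^ (2 * y) \<le> j ^ 2" by (simp add: power_mult[symmetric] mult.commute)
      show "j \<le> j ^ 2" by (cases j) (auto simp: power2_eq_square)
    qed
    finally have "real (divisor_count (a + M * t + j)) \<le> real (j ^ 2 + j ^ 2)" by (rule of_nat_mono)
    also have "\<dots> \<le> 4 * (3 / 2) ^ j" using square_le_three_halves_power[of j] j16 by simp
    finally show "real (divisor_count (a + M * t + j)) \<le> 4 * (3 / 2) ^ j" .
  qed
  also have "\<dots> = 1 * (2 ^ y * 4) * (3 / 2) ^ j" by simp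
  also have "\<dots> \<le> real (divisor_count (R K ^ 2)) * (2 ^ y * (2 * real y + 4)) * (3 / 2) ^ j"
  proof -
    have "1 \<le> divisor_count (R K ^ 2)" using divisor_count_pos[of "R K ^ 2"] R_pos[OF K] by simp
    hence "1 \<le> real (divisor_count (R K ^ 2))" by simp
    thus ?thesis by (intro mult_right_mono mult_mono) auto
  qed
  finally show ?thesis .
qed

text \<open>Summing over \<open>t\<close> first reduces the tails to a geometric series of ratio
  \<open>3 / 4\<close>, whose sum is 4.\<close>

lemma sum_tails_le:
  "(\<Sum>t<2^y. \<Sum>j. real (divisor_count (a + M * t + (Suc L + j))) / 2 ^ (Suc L + j))
    \<le> real (divisor_count (R K ^ 2)) * (2 ^ y * (2 * real y + 4)) * (4 * (3 / 4) ^ Suc L)"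
proof -
  let ?g = "\<lambda>t j. real (divisor_count (a + M * t + (Suc L + j))) / 2 ^ (Suc L + j)"
  define C where "C = real (divisor_count (R K ^ 2)) * (2 ^ y * (2 * real y + 4))"
  have "(\<Sum>t<2^y. suminf (?g t)) = (\<Sum>j. \<Sum>t<2^y. ?g t j)"
    by (intro suminf_sum[symmetric] summable_divisor_count_shift)
  also have "\<dots> \<le> (\<Sum>j. C * (3 / 4) ^ Suc L * (3 / 4) ^ j)"
  proof (rule suminf_le)
    show "(\<Sum>t<2^y. ?g t j) \<le> C * (3 / 4) ^ Suc L * (3 / 4) ^ j" for j
    proof -
      have "(\<Sum>t<2^y. ?g t j) \<le> C * (3 / 2) ^ (Suc L + j) / 2 ^ (Suc L + j)"
        unfolding sum_divide_distrib[symmetric] C_def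
        by (intro divide_right_mono sum_divisor_count_shift_le) auto
      also have "\<dots> = C * (3 / 4) ^ (Suc L + j)"
        by (simp only: times_divide_eq_right[symmetric] power_divide[symmetric]) simp
      finally show ?thesis by (simp add: power_add mult_ac)
    qed
    show "summable (\<lambda>j. \<Sum>t<2^y. ?g t j)"
      by (intro summable_sum summable_divisor_count_shift)
    show "summable (\<lambda>j. C * (3 / 4) ^ Suc L * (3 / 4) ^ j)"
      by (intro summable_mult summable_geometric) simp
  qed
  also have "\<dots> = C * (3 / 4) ^ Suc L * (\<Sum>j. (3 / 4) ^ j)"
    by (intro suminf_mult summable_geometric) simp
  also have "(\<Sum>j. (3 / 4 :: real) ^ j) = 4"
    by (subst suminf_geometric) auto
  finally show ?thesis by (simp add: C_def mult_ac)
qed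

text \<open>\<open>M * t\<close> vanishes mod \<open>R i ^ 2\<close>, so the congruence at
  \<open>a + i\<close> persists along the whole class.\<close>

lemma divisor_count_factorisation:
  assumes "i \<in> {1..L}"
  obtains v where "divisor_count (a + M * t + i) = divisor_count (R i) * v"
proof -
  have "R i ^ 2 dvd M" unfolding M_eq using assms by (intro dvd_prodI) auto
  hence "[M * t = 0] (mod R i ^ 2)" by (auto simp: cong_0_iff)
  hence "[(a + i) + M * t = R i + 0] (mod R i ^ 2)" by (intro cong_add R_cong assms)
  hence "[a + M * t + i = R i] (mod R i ^ 2)" by (simp add: add_ac)
  then obtain v where "a + M * t + i = R i * v" "coprime (R i) v"
    using cong_self_mod_square_imp_coprime_factor R_pos[OF assms] by blast
  hence "divisor_count (a + M * t + i) = divisor_count (R i) * divisor_count v"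
    by (simp add: divisor_count_mult_coprime)
  thus ?thesis using that by blast
qed

text \<open>The cofactors at \<open>K\<close> form a progression with step
  \<open>m = M / R K\<close>. Its start \<open>v\<close> is coprime to \<open>m\<close>: a prime
  shared with some other \<open>R i\<close> would divide \<open>K - i\<close>, yet be at least
  \<open>4 * L\<close>. So the average holds without a gcd loss.\<close>

lemma obtain_cofactor_progression:
  obtains v m where "\<And>t. divisor_count (a + M * t + K) = divisor_count (R K) * divisor_count (v + m * t)"
    "v > 0" "(\<Sum>t<2^y. real (divisor_count (v + m * t))) \<le> 2 ^ y * (2 * real y + 4)"
proof -
  obtain v where v: "a + K = R K * v" "coprime (R K) v"
    using cong_self_mod_square_imp_coprime_factor[OF R_cong[OF K] R_pos[OF K]] by blast
  define m where "m = R K * (\<Prod>i\<in>{1..L}-{K}. R i ^ 2)"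
  have M: "M = R K * m"
    unfolding M_eq m_def using K by (subst prod.remove[of _ K]) (auto simp: power2_eq_square)
  have vpos: "v > 0" using v(1) K by (auto intro!: gr0I)
  have "coprime v (R i)" if i: "i \<in> {1..L} - {K}" for i
  proof (rule ccontr)
    assume "\<not> coprime v (R i)"
    hence "gcd v (R i) \<noteq> 1" using coprime_iff_gcd_eq_1 by blast
    then obtain p where "prime p" "p dvd gcd v (R i)" using prime_factor_nat by blast
    hence p: "prime p" "p dvd v" "p dvd R i" by simp_all
    have "p dvd a + K" using p(2) v(1) by simp
    moreover have "p dvd a + i" using p(3) R_dvd[of i] i by (meson DiffD1 dvd_trans)
    ultimately have "int p dvd int (a + K) - int (a + i)" by (intro dvd_diff) (simp_all only: int_dvd_int_iff)
    hence "int p dvd int K - int i" by simp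
    moreover have "int K - int i \<noteq> 0" using i by auto
    ultimately have "int p \<le> \<bar>int K - int i\<bar>" using dvd_imp_le_int[of "int K - int i" "int p"] by simp
    moreover have "4 * L \<le> p" using R_primes[OF i] p by auto
    ultimately show False using K i by auto
  qed
  hence "coprime v (\<Prod>i\<in>{1..L}-{K}. R i ^ 2)" by (intro prod_coprime_right) simp
  hence "coprime v m" unfolding m_def using v(2) by (simp add: coprime_commute)
  moreover have "v + m * 2 ^ y \<le> 2 ^ (2 * y)"
  proof -
    have "v + m * 2 ^ y \<le> R K * (v + m * 2 ^ y)" using R_pos[OF K] by simp
    also have "\<dots> = a + K + M * 2 ^ y" using v(1) M by (simp add: algebra_simps)
    also have "\<dots> \<le> 2 ^ (2 * y)" by (rule progression_le[OF K_le])
    finally show ?thesis .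
  qed
  ultimately have "(\<Sum>t<2^y. real (divisor_count (v + m * t))) \<le> 2 ^ y * (2 * real y + 4)"
    using vpos by (intro sum_divisor_count_progression_le)
  moreover have "divisor_count (a + M * t + K) = divisor_count (R K) * divisor_count (v + m * t)" for t
  proof -
    have "coprime (R K) (v + m * t)"
    proof (rule coprimeI)
      fix d assume d: "d dvd R K" "d dvd v + m * t"
      have "d dvd m * t" unfolding m_def using d(1) by auto
      hence "d dvd v" using d(2) by (simp add: dvd_add_left_iff)
      thus "is_unit d" using d(1) v(2) coprime_common_divisor by blast
    qed
    moreover have "a + M * t + K = R K * (v + m * t)" using v(1) M by (simp add: algebra_simps)
    ultimately show ?thesis by (simp add: divisor_count_mult_coprime)
  qed
  ultimately show ?thesis using that vpos by blast
qed

lemma obtain_digits_11: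
  assumes dK: "divisor_count (R K) = 2 ^ K - 1"
    and di: "\<And>i. i \<in> {1..L} - {K} \<Longrightarrow> 2 ^ i dvd divisor_count (R i)"
    and small: "(2 * real y + 4) * (4 / 2 ^ K)
      + 2 ^ K * (real (divisor_count (R K ^ 2)) * (2 * real y + 4) * (4 * (3 / 4) ^ Suc L)) < 1"
  obtains t where "binary_digit erdos_borwein (a + M * t + 1) = 1"
    "binary_digit erdos_borwein (a + M * t + 2) = 1"
proof -
  define T where "T = (\<lambda>t. \<Sum>j. real (divisor_count (a + M * t + (Suc L + j))) / 2 ^ (Suc L + j))"
  define c where "c = 2 * real y + 4"
  define D where "D = real (divisor_count (R K ^ 2))"
  obtain v m where vm: "\<And>t. divisor_count (a + M * t + K) = divisor_count (R K) * divisor_count (v + m * t)"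
    "v > 0" "(\<Sum>t<2^y. real (divisor_count (v + m * t))) \<le> 2 ^ y * c"
    using obtain_cofactor_progression unfolding c_def by metis
  \<comment> \<open>Both summands are nonnegative, so \<open>F t < 1\<close> gives
    \<open>4 * w < 2 ^ K\<close> and a tail below \<open>1 / 2 ^ K\<close> for the same
    \<open>t\<close>. Such a \<open>t\<close> exists because the mean of \<open>F\<close> is below
    1.\<close>
  define F where "F = (\<lambda>t. real (divisor_count (v + m * t)) * (4 / 2 ^ K) + 2 ^ K * T t)"
  have "\<exists>t<2^y. F t < 1"
  proof (rule ccontr)
    assume "\<not> ?thesis"
    hence "(\<Sum>t<2^y::nat. 1) \<le> (\<Sum>t<2^y. F t)" by (intro sum_mono) force
    also have "\<dots> = (\<Sum>t<2^y. real (divisor_count (v + m * t))) * (4 / 2 ^ K) + 2 ^ K * (\<Sum>t<2^y. T t)"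
      unfolding F_def by (simp add: sum.distrib sum_distrib_left sum_distrib_right sum_divide_distrib)
    also have "\<dots> \<le> (2 ^ y * c) * (4 / 2 ^ K) + 2 ^ K * (D * (2 ^ y * c) * (4 * (3 / 4) ^ Suc L))"
      using vm(3) sum_tails_le unfolding T_def c_def D_def
      by (intro add_mono mult_left_mono mult_right_mono) auto
    also have "\<dots> = 2 ^ y * (c * (4 / 2 ^ K) + 2 ^ K * (D * c * (4 * (3 / 4) ^ Suc L)))"
      by (simp add: algebra_simps)
    also have "\<dots> < 2 ^ y * 1" using small unfolding c_def D_def by (intro mult_strict_left_mono) auto
    finally show False by simp
  qed
  then obtain t where F: "F t < 1" by blast
  define w where "w = divisor_count (v + m * t)"
  have T0: "T t \<ge> 0" unfolding T_def by (intro suminf_nonneg summable_divisor_count_shift) auto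
  have "real w * (4 / 2 ^ K) < 1" "2 ^ K * T t < 1"
    using F T0 unfolding F_def w_def[symmetric]
    by (smt (verit) divide_nonneg_nonneg mult_nonneg_nonneg of_nat_0_le_iff zero_le_power)+
  hence "real (4 * w) \<le> real (2 ^ K)" by (simp add: field_simps)
  hence w4: "4 * w \<le> 2 ^ K" by (simp only: of_nat_le_iff)
  have w0: "w > 0" unfolding w_def using vm(2) by (intro divisor_count_pos) auto
  have dvd: "2 ^ j dvd divisor_count (a + M * t + j)" if j: "j \<in> {1..L} - {K}" for j
  proof -
    obtain q where "divisor_count (a + M * t + j) = divisor_count (R j) * q"
      using divisor_count_factorisation[of j t] j by auto
    thus ?thesis using di[OF j] by simp
  qed
  have dK': "divisor_count (a + M * t + K) = (2 ^ K - 1) * w"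
    using vm(1)[of t] dK by (simp add: w_def)
  show ?thesis
    using erdos_borwein_digits_11[OF K dvd dK' w0 w4] \<open>2 ^ K * T t < 1\<close> that
    unfolding T_def by blast
qed

end

section \<open>Choice of the parameters\<close>

text \<open>The bracket from \<open>y\<close> is of order \<open>2 ^ h\<close>, beaten by
  \<open>2 ^ (2 * h) = 4 ^ h\<close>. In the tail term \<open>L = 32 * h\<close> gives
  \<open>(3/4) ^ L \<le> 1 / 4096 ^ h\<close>, which absorbs the powers of size
  \<open>16 ^ h\<close> and leaves \<open>1 / 256 ^ h\<close>.\<close>

lemma eventually_parameters_small:
  "eventually (\<lambda>h::nat.
     (2 * real (24 * (32 * h) ^ 4 + 6 * 2 ^ h + 1) + 4) * (4 / 2 ^ (2 * h))
     + 2 ^ (2 * h) * (2 ^ (2 * h + 3) * (2 * real (24 * (32 * h) ^ 4 + 6 * 2 ^ h + 1) + 4)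
         * (4 * (3 / 4) ^ Suc (32 * h))) < 1) at_top"
proof -
  have "((\<lambda>h::nat. (2 * (24 * (32 * real h) ^ 4 + 6 * 2 ^ h + 1) + 4) * (4 / 4 ^ h)
      + (2 * (24 * (32 * real h) ^ 4 + 6 * 2 ^ h + 1) + 4) * (32 / 256 ^ h)) \<longlongrightarrow> 0 + 0) at_top"
    by (intro tendsto_add) real_asymp+
  hence "eventually (\<lambda>h::nat. (2 * (24 * (32 * real h) ^ 4 + 6 * 2 ^ h + 1) + 4) * (4 / 4 ^ h)
      + (2 * (24 * (32 * real h) ^ 4 + 6 * 2 ^ h + 1) + 4) * (32 / 256 ^ h) < 1) at_top"
    by (rule order_tendstoD) simp
  thus ?thesis
  proof eventually_elim
    case (elim h)
    have eq: "(2::real) ^ (2 * h) = 4 ^ h" "(2::real) ^ (2 * h + 3) = 8 * 4 ^ h"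
      by (simp_all add: power_add power_mult)
    have "(3 / 4 :: real) ^ Suc (32 * h) \<le> (3 / 4) ^ (32 * h)" by (intro power_decreasing) auto
    also have "\<dots> = ((3 / 4) ^ 32) ^ h" by (simp add: power_mult)
    also have "\<dots> \<le> (1 / 4096) ^ h" by (intro power_mono) (auto simp: power_divide)
    finally have le: "(3 / 4 :: real) ^ Suc (32 * h) \<le> (1 / 4096) ^ h" .
    have y: "real (24 * (32 * h) ^ 4 + 6 * 2 ^ h + 1) = 24 * (32 * real h) ^ 4 + 6 * 2 ^ h + 1"
      by simp
    define Z where "Z = 2 * (24 * (32 * real h) ^ 4 + 6 * 2 ^ h + 1) + 4"
    have "Z * (4 / 4 ^ h) + 4 ^ h * (8 * 4 ^ h * Z * (4 * (3 / 4) ^ Suc (32 * h)))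
        \<le> Z * (4 / 4 ^ h) + 4 ^ h * (8 * 4 ^ h * Z * (4 * (1 / 4096) ^ h))"
      using le by (intro add_mono mult_left_mono) (auto simp: Z_def)
    also have "4 ^ h * (8 * 4 ^ h * Z * (4 * (1 / 4096) ^ h)) = 32 * Z * (4 * 4 * (1 / 4096)) ^ h"
      by (simp only: power_mult_distrib mult_ac)
    also have "\<dots> = Z * (32 / 256 ^ h)" by (simp add: power_divide)
    finally show ?case using elim unfolding eq y Z_def by linarith
  qed
qed

lemma exists_digits_11:
  fixes h L K y :: nat
  assumes h: "h \<ge> 1" and L: "L = 32 * h" and K: "K = 2 * h" and y: "y = 24 * L ^ 4 + 6 * 2 ^ h + 1"
    and small: "(2 * real y + 4) * (4 / 2 ^ K)
      + 2 ^ K * (2 ^ (2 * h + 3) * (2 * real y + 4) * (4 * (3 / 4) ^ Suc L)) < 1"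
  shows "\<exists>N\<ge>h. binary_digit erdos_borwein (N + 1) = 1 \<and> binary_digit erdos_borwein (N + 2) = 1"
proof -
  define p where "p = enumerate {p::nat. prime p}"
  \<comment> \<open>For \<open>s < i \<le> L\<close> the part \<open>i * L + s\<close> has quotient
    \<open>i\<close> and remainder \<open>s\<close> on division by \<open>L\<close> unless
    \<open>s\<close> could reach \<open>L\<close>, which it cannot; so indices never repeat. The
    offset forces the primes to be at least \<open>4 * L\<close>.\<close>
  define idx where "idx = (\<lambda>i s. 4 * L + i * L + s :: nat)"
  define Q where "Q = (\<lambda>i. \<Prod>s<i. p (idx i s))"
  define u :: nat where "u = 2 ^ (2 ^ h - 2) * 3 ^ (2 ^ h)"
  define R where "R = (\<lambda>i. if i = K then u else Q i)"
  define M where "M = (\<Prod>i=1..L. R i ^ 2)"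
  have Lpos: "L \<ge> 32" using h L by simp
  have KL: "K \<in> {1..L}" using h K L by auto
  have p_prime: "prime (p n)" for n
    using enumerate_in_set[OF primes_infinite] unfolding p_def by blast
  have p_inj: "p m = p n \<longleftrightarrow> m = n" for m n
    using inj_enumerate[OF primes_infinite] unfolding p_def by (auto dest: injD)
  have p_ge: "n \<le> p n" for n unfolding p_def by (rule le_enumerate[OF primes_infinite])
  have p_le: "p n \<le> 4 ^ Suc n" for n unfolding p_def by (rule enumerate_primes_le)
  have p_idx_ge: "4 * L \<le> p (idx i s)" for i s using p_ge[of "idx i s"] by (simp add: idx_def)
  have idx_inj: "i = i' \<and> s = s'"
    if "idx i s = idx i' s'" "s < i" "i \<le> L" "s' < i'" "i' \<le> L" for i s i' s'
  proof -
    have eq: "i * L + s = i' * L + s'" using that by (simp add: idx_def)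
    have "(i * L + s) div L = i" "(i' * L + s') div L = i'" using that by auto
    hence "i = i'" using eq by simp
    thus ?thesis using eq by simp
  qed
  have Q_prime: "4 * L \<le> q" if q: "prime q" "q dvd Q i" for q i
  proof -
    obtain s where "q dvd p (idx i s)"
      using q unfolding Q_def by (auto simp: prime_dvd_prod_iff)
    hence "q = p (idx i s)" using q(1) p_prime primes_dvd_imp_eq by blast
    thus ?thesis using p_idx_ge by simp
  qed
  have Q_pos: "Q i > 0" for i unfolding Q_def by (auto intro!: prod_pos prime_gt_0_nat p_prime)
  have u_pos: "u > 0" by (simp add: u_def)
  have R_pos: "R i > 0" for i using Q_pos u_pos by (simp add: R_def)
  have cop_Q: "coprime (Q i) (Q j)" if "i \<in> {1..L}" "j \<in> {1..L}" "i \<noteq> j" for i j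
    unfolding Q_def
  proof (intro prod_coprime_left prod_coprime_right primes_coprime p_prime)
    fix s t assume "s \<in> {..<i}" "t \<in> {..<j}"
    thus "p (idx i s) \<noteq> p (idx j t)" using that idx_inj[of i s j t] by (auto simp only: p_inj atLeastAtMost_iff lessThan_iff)
  qed
  have cop_u: "coprime u (Q i)" for i
  proof -
    have "coprime q (Q i)" if "prime q" "q < 4 * L" for q
      using that Q_prime prime_imp_coprime by (meson not_less)
    from this[of 2] this[of 3] have "coprime 2 (Q i)" "coprime 3 (Q i)" using Lpos by simp_all
    thus ?thesis by (simp add: u_def)
  qed
  have cop: "coprime (R i) (R j)" if "i \<in> {1..L}" "j \<in> {1..L}" "i \<noteq> j" for i j
    using that cop_Q cop_u[of i] cop_u[of j] unfolding R_def by (auto simp: coprime_commute)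
  have M_pos: "M > 0" unfolding M_def using R_pos by (auto intro!: prod_pos)

  \<comment> \<open>The residue is \<open>R i - i\<close> mod \<open>R i ^ 2\<close>, written
    without subtracting \<open>i\<close> in the naturals.\<close>
  obtain x where x: "\<forall>i\<in>{1..L}. [x = R i + (R i ^ 2 - 1) * i] (mod R i ^ 2)"
    using chinese_remainder_nat[of "{1..L}" "\<lambda>i. R i ^ 2" "\<lambda>i. R i + (R i ^ 2 - 1) * i"] cop by auto
  define a where "a = x mod M"
  have R_cong: "[a + i = R i] (mod R i ^ 2)" if i: "i \<in> {1..L}" for i
  proof -
    have "R i ^ 2 dvd M" unfolding M_def using i by (intro dvd_prodI) auto
    hence "[a = x] (mod R i ^ 2)" unfolding a_def cong_def by (rule mod_mod_cancel)
    also have "[x = R i + (R i ^ 2 - 1) * i] (mod R i ^ 2)" using x i by blast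
    finally have "[a + i = R i + (R i ^ 2 - 1) * i + i] (mod R i ^ 2)" by (intro cong_add) auto
    also have "R i + (R i ^ 2 - 1) * i + i = R i + R i ^ 2 * i"
      using R_pos[of i] by (metis Suc_diff_1 add.assoc add.commute mult_Suc zero_less_power)
    also have "[R i + R i ^ 2 * i = R i] (mod R i ^ 2)" by (simp add: cong_def)
    finally show ?thesis .
  qed

  have Q_le: "Q i \<le> 4 ^ (6 * L ^ 3)" if i: "i \<in> {1..L}" for i
  proof -
    have "Q i \<le> (\<Prod>s<i. 4 ^ (6 * L ^ 2))"
      unfolding Q_def
    proof (intro prod_mono conjI)
      fix s assume s: "s \<in> {..<i}"
      have "L \<le> L ^ 2" using Lpos by (simp add: power2_eq_square)
      moreover have "i * L \<le> L ^ 2" using i by (simp add: power2_eq_square)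
      \<comment> \<open>The index bound is \<open>4 * L + L ^ 2 + L\<close>, at most
        \<open>6 * L ^ 2\<close>.\<close>
      ultimately have "Suc (idx i s) \<le> 6 * L ^ 2" using s i by (auto simp: idx_def)
      hence "(4::nat) ^ Suc (idx i s) \<le> 4 ^ (6 * L ^ 2)" by (intro power_increasing) auto
      thus "p (idx i s) \<le> 4 ^ (6 * L ^ 2)" using p_le order_trans by blast
    qed auto
    also have "\<dots> = 4 ^ (6 * L ^ 2 * i)" by (simp add: power_mult)
    also have "\<dots> \<le> 4 ^ (6 * L ^ 3)"
      using i by (intro power_increasing) (auto simp: power3_eq_cube power2_eq_square)
    finally show ?thesis .
  qed
  have "u \<le> 2 ^ (2 ^ h) * 4 ^ (2 ^ h)"
    unfolding u_def by (intro mult_le_mono power_increasing power_mono) auto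
  also have "\<dots> = 2 ^ (3 * 2 ^ h)"
    by (simp add: power_mult power_mult_distrib[symmetric])
  finally have u_le: "u \<le> 2 ^ (3 * 2 ^ h)" .
  \<comment> \<open>Bit count of \<open>M\<close>: \<open>u ^ 2\<close> contributes
    \<open>6 * 2 ^ h\<close> and the other factors at most \<open>24 * L ^ 4\<close>. One more bit
    in \<open>y\<close> gives \<open>2 * M \<le> 2 ^ y\<close>.\<close>
  have "M = u ^ 2 * (\<Prod>i\<in>{1..L} - {K}. Q i ^ 2)"
    unfolding M_def using KL by (subst prod.remove[of _ K]) (auto simp: R_def intro!: prod.cong)
  also have "\<dots> \<le> (2 ^ (3 * 2 ^ h)) ^ 2 * (\<Prod>i\<in>{1..L} - {K}. (4 ^ (6 * L ^ 3)) ^ 2)"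
    using u_le Q_le by (intro mult_le_mono power_mono prod_mono) auto
  also have "(\<Prod>i\<in>{1..L} - {K}. ((4::nat) ^ (6 * L ^ 3)) ^ 2) \<le> ((4 ^ (6 * L ^ 3)) ^ 2) ^ L"
    using KL by (auto simp: card_Diff_singleton intro!: power_increasing)
  also have "\<dots> = (2::nat) ^ (2 * ((6 * L ^ 3) * (2 * L)))"
    by (simp only: power_mult) simp
  also have "2 * ((6 * L ^ 3) * (2 * L)) = 24 * L ^ 4"
    by (simp add: power3_eq_cube power4_eq_xxxx)
  also have "((2::nat) ^ (3 * 2 ^ h)) ^ 2 * 2 ^ (24 * L ^ 4) = 2 ^ (24 * L ^ 4 + 6 * 2 ^ h)"
    by (simp add: power_mult[symmetric] power_add mult_ac)
  finally have M_le: "M \<le> 2 ^ (24 * L ^ 4 + 6 * 2 ^ h)" by simp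

  have two_h: "(2::nat) \<le> 2 ^ h" using h by (cases h) auto
  have "divisor_count u = Suc (2 ^ h - 2) * Suc (2 ^ h)"
    unfolding u_def by (subst divisor_count_mult_coprime) (auto simp: divisor_count_prime_power)
  also have "\<dots> = (2 ^ h) ^ 2 - 1"
  proof -
    obtain b :: nat where b: "2 ^ h = b + 2" using two_h by (metis add.commute le_Suc_ex)
    show ?thesis unfolding b by (simp add: power2_eq_square)
  qed
  also have "\<dots> = 2 ^ K - 1" by (simp add: K power_mult[symmetric] mult.commute)
  finally have dK: "divisor_count u = 2 ^ K - 1" .
  \<comment> \<open>This divisor count is the loss at \<open>K\<close> in the tail estimate; the
    small exponents of \<open>u\<close> keep it of order \<open>4 ^ h\<close>.\<close>
  have "u ^ 2 = 2 ^ (2 * (2 ^ h - 2)) * 3 ^ (2 * 2 ^ h)"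
    unfolding u_def by (simp only: power_mult_distrib power_mult[symmetric] mult.commute)
  hence "divisor_count (u ^ 2) = Suc (2 * (2 ^ h - 2)) * Suc (2 * 2 ^ h)"
    by (simp add: divisor_count_mult_coprime divisor_count_prime_power del: mult_Suc mult_Suc_right)
  also have "\<dots> \<le> (2 * 2 ^ h) * (4 * 2 ^ h)" using two_h by (intro mult_le_mono) auto
  also have "\<dots> = 2 ^ (2 * h + 3)" by (simp add: power_add power_even_eq power2_eq_square)
  finally have "real (divisor_count (u ^ 2)) \<le> real (2 ^ (2 * h + 3))" by (rule of_nat_mono)
  hence du2: "real (divisor_count (u ^ 2)) \<le> 2 ^ (2 * h + 3)" by simp

  interpret residue_system R L K a M y
  proof
    show "4 * L \<le> q" if "i \<in> {1..L} - {K}" "prime q" "q dvd R i" for i q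
      using that Q_prime[of q i] by (auto simp: R_def)
    show "a < M" unfolding a_def using M_pos by simp
    show "2 * M \<le> 2 ^ y" using M_le by (simp add: y)
    show "4 \<le> y" using two_h by (simp add: y)
    have "K \<le> y" using two_h Lpos K L h self_le_power[of L 4] by (simp add: y)
    thus "K \<le> 2 ^ y" using less_exp[of y] by linarith
  qed (use KL R_pos R_cong M_def in auto)
  have "2 ^ i dvd divisor_count (R i)" if i: "i \<in> {1..L} - {K}" for i
  proof -
    have "divisor_count (Q i) = 2 ^ card {..<i}"
      unfolding Q_def by (rule divisor_count_prod_primes) (auto simp: inj_on_def p_inj p_prime idx_def)
    thus ?thesis using i by (simp add: R_def)
  qed
  moreover have "divisor_count (R K) = 2 ^ K - 1" using dK by (simp add: R_def)
  moreover have "(2 * real y + 4) * (4 / 2 ^ K)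
      + 2 ^ K * (real (divisor_count (R K ^ 2)) * (2 * real y + 4) * (4 * (3 / 4) ^ Suc L)) < 1"
    using du2 unfolding R_def
    by (intro le_less_trans[OF _ small] add_mono mult_left_mono mult_right_mono) auto
  ultimately obtain t where t: "binary_digit erdos_borwein (a + M * t + 1) = 1"
      "binary_digit erdos_borwein (a + M * t + 2) = 1"
    using obtain_digits_11 by blast
  \<comment> \<open>Makes the position unbounded: \<open>u\<close> divides \<open>a + K\<close> and
    is at least \<open>3 * h = K + h\<close>.\<close>
  have "h \<le> a"
  proof -
    have "h + 1 \<le> 2 ^ h" using less_exp[of h] by linarith
    hence "(3::nat) ^ (h + 1) \<le> 3 ^ (2 ^ h)" by (intro power_increasing) auto
    moreover have "h < 3 ^ h" by (rule less_le_trans[OF less_exp power_mono]) auto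
    ultimately have "3 * h \<le> 3 ^ (2 ^ h)" by simp
    also have "\<dots> \<le> u" by (simp add: u_def)
    also have "u \<le> a + K" using R_dvd[OF KL] KL by (auto simp: R_def dest: dvd_imp_le)
    finally show ?thesis using assms(3) by linarith
  qed
  with t show ?thesis by (intro exI[of _ "a + M * t"]) auto
qed

theorem mainTheorem3:
  shows "infinite {n::nat. n \<ge> 1 \<and> binary_digit erdos_borwein n = 1
                            \<and> binary_digit erdos_borwein (n + 1) = 1}"
  unfolding infinite_nat_iff_unbounded_le
proof
  fix m :: nat
  obtain h where h: "h \<ge> max 1 m"
    "(2 * real (24 * (32 * h) ^ 4 + 6 * 2 ^ h + 1) + 4) * (4 / 2 ^ (2 * h))
     + 2 ^ (2 * h) * (2 ^ (2 * h + 3) * (2 * real (24 * (32 * h) ^ 4 + 6 * 2 ^ h + 1) + 4)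
         * (4 * (3 / 4) ^ Suc (32 * h))) < 1"
    using eventually_happens'[OF sequentially_bot
        eventually_conj[OF eventually_ge_at_top eventually_parameters_small]] by blast
  obtain N where "N \<ge> h" "binary_digit erdos_borwein (N + 1) = 1"
      "binary_digit erdos_borwein (N + 2) = 1"
    using exists_digits_11[OF _ refl refl refl h(2)] h(1) by auto
  thus "\<exists>n\<ge>m. n \<in> {n. n \<ge> 1 \<and> binary_digit erdos_borwein n = 1
      \<and> binary_digit erdos_borwein (n + 1) = 1}"
    using h(1) by (intro exI[of _ "N + 1"]) auto
qed

end
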